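(* Let $\mathcal T$ be a triangulation of a (connected) simply connected manifold. Then the assignment $$d_{ij}=\frac{\ell_{ij}^2+w_i-w_j}{2\ell_{ij}}$$ defines a bijection between weighted triangulations $(\mathcal T,\ell,w)$ up to weight scaling and duality triangulations $(\mathcal T,d)$.
   Context: $\mathcal T$ is a topological triangulation of an $n$-dimensional manifold; $\mathcal T_k$ denotes its set of $k$-simplices and $\mathcal T_1^+$ its set of directed edges (so $(i,j)\neq(j,i)$). A Euclidean triangulation $(\mathcal T,\ell)$ is an assignment $\ell:\mathcal T_1\to(0,\infty)$ such that each simplex of $\mathcal T$ is realized by a nondegenerate Euclidean simplex with the assigned edge lengths. A weighted triangulation $(\mathcal T,\ell,w)$ is a Euclidean triangulation with a function $w:\mathcal T_0\to\mathbb R$. A weight scaling replaces $w_i$ by $w_i+t$ for all vertices $i$ simultaneously, with one $t\in\mathbb R$, leaving $\ell$ unchanged. A duality triangulation $(\mathcal T,d)$ is a function $d:\mathcal T_1^+\to\mathbb R$ such that $d_{ij}^2+d_{jk}^2+d_{ki}^2=d_{ji}^2+d_{ik}^2+d_{kj}^2$ for each $\{i,j,k\}\in\mathcal T_2$ and such that the induced lengths $\ell_{ij}=d_{ij}+d_{ji}$ make $(\mathcal T,\ell)$ a Euclidean triangulation. *)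

theory Defs
  imports "HOL-Analysis.Analysis"
begin

section \<open>Simplicial complexes and triangulated manifolds\<close>

text \<open>Simplices are identified with their vertex sets; infinite complexes are allowed.
  The constant \<open>simplicial_complex\<close> of \<^theory>\<open>HOL-Analysis.Polytope\<close> is not suitable, since it
  is restricted to finite complexes of convex simplices in a Euclidean space.\<close>

definition abstract_simplicial_complex :: "'v set set \<Rightarrow> bool" where
  "abstract_simplicial_complex T \<longleftrightarrow>
     (\<forall>\<sigma>\<in>T. finite \<sigma> \<and> \<sigma> \<noteq> {} \<and> (\<forall>\<tau>. \<tau> \<subseteq> \<sigma> \<and> \<tau> \<noteq> {} \<longrightarrow> \<tau> \<in> T))"

definition simplices :: "'v set set \<Rightarrow> nat \<Rightarrow> 'v set set" where
  "simplices T k = {\<sigma> \<in> T. card \<sigma> = Suc k}"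

definition vertices :: "'v set set \<Rightarrow> 'v set" where
  "vertices T = {i. {i} \<in> simplices T 0}"

definition directed_edges :: "'v set set \<Rightarrow> ('v \<times> 'v) set" where
  "directed_edges T = {(i, j). {i, j} \<in> simplices T 1}"

lemma directed_edges_iff: "(i, j) \<in> directed_edges T \<longleftrightarrow> i \<noteq> j \<and> {i, j} \<in> T"
  by (cases "i = j") (auto simp: directed_edges_def simplices_def)

text \<open>Points of the geometric realization are given by their barycentric coordinates.\<close>

definition realization_points :: "'v set set \<Rightarrow> ('v \<Rightarrow> real) set" where
  "realization_points T =
     {x. (\<forall>v. 0 \<le> x v) \<and> {v. x v \<noteq> 0} \<in> T \<and> (\<Sum>v | x v \<noteq> 0. x v) = 1}"

definition realization_face :: "'v set set \<Rightarrow> 'v set \<Rightarrow> ('v \<Rightarrow> real) set" where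
  "realization_face T \<sigma> = {x \<in> realization_points T. {v. x v \<noteq> 0} \<subseteq> \<sigma>}"

text \<open>The realization carries the weak topology: a set is open iff its trace on every closed
  simplex is. On a single (finite) simplex the product topology of \<open>'v \<Rightarrow> real\<close> is the usual
  Euclidean one.\<close>

definition realization :: "'v set set \<Rightarrow> ('v \<Rightarrow> real) topology" where
  "realization T = topology (\<lambda>U. U \<subseteq> realization_points T \<and>
     (\<forall>\<sigma>\<in>T. openin (top_of_set (realization_face T \<sigma>)) (U \<inter> realization_face T \<sigma>)))"

lemma openin_realization:
  "openin (realization T) U \<longleftrightarrow> U \<subseteq> realization_points T \<and>
     (\<forall>\<sigma>\<in>T. openin (top_of_set (realization_face T \<sigma>)) (U \<inter> realization_face T \<sigma>))"
proof -
  have "istopology (\<lambda>U. U \<subseteq> realization_points T \<and>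
     (\<forall>\<sigma>\<in>T. openin (top_of_set (realization_face T \<sigma>)) (U \<inter> realization_face T \<sigma>)))"
    unfolding istopology_def
  proof (intro conjI allI impI ballI)
    fix S S' \<sigma>
    assume S: "S \<subseteq> realization_points T \<and>
        (\<forall>\<sigma>\<in>T. openin (top_of_set (realization_face T \<sigma>)) (S \<inter> realization_face T \<sigma>))"
      and S': "S' \<subseteq> realization_points T \<and>
        (\<forall>\<sigma>\<in>T. openin (top_of_set (realization_face T \<sigma>)) (S' \<inter> realization_face T \<sigma>))"
    show "S \<inter> S' \<subseteq> realization_points T" using S by blast
    assume "\<sigma> \<in> T"
    then have "openin (top_of_set (realization_face T \<sigma>))
        ((S \<inter> realization_face T \<sigma>) \<inter> (S' \<inter> realization_face T \<sigma>))"
      using S S' by (simp only: openin_Int)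
    then show "openin (top_of_set (realization_face T \<sigma>)) (S \<inter> S' \<inter> realization_face T \<sigma>)"
      by (simp add: Int_ac)
  next
    fix \<K> \<sigma>
    assume K: "\<forall>K\<in>\<K>. K \<subseteq> realization_points T \<and>
        (\<forall>\<sigma>\<in>T. openin (top_of_set (realization_face T \<sigma>)) (K \<inter> realization_face T \<sigma>))"
    show "\<Union>\<K> \<subseteq> realization_points T" using K by blast
    assume "\<sigma> \<in> T"
    then have "openin (top_of_set (realization_face T \<sigma>)) (\<Union>K\<in>\<K>. K \<inter> realization_face T \<sigma>)"
      using K by (intro openin_Union) auto
    then show "openin (top_of_set (realization_face T \<sigma>)) (\<Union>\<K> \<inter> realization_face T \<sigma>)"
      by (simp add: Int_commute Int_Union)
  qed
  then show ?thesis by (simp add: realization_def)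
qed

lemma topspace_realization: "topspace (realization T) = realization_points T"
proof (rule subset_antisym)
  show "topspace (realization T) \<subseteq> realization_points T"
    using openin_realization openin_topspace by blast
  have "realization_points T \<inter> realization_face T \<sigma> = realization_face T \<sigma>" for \<sigma>
    by (auto simp: realization_face_def)
  then have "openin (realization T) (realization_points T)"
    by (simp add: openin_realization)
  then show "realization_points T \<subseteq> topspace (realization T)"
    by (rule openin_subset)
qed

text \<open>Manifolds are without boundary, and need not be compact.\<close>

definition topological_manifold :: "nat \<Rightarrow> 'a topology \<Rightarrow> bool" where
  "topological_manifold n X \<longleftrightarrow>
     Hausdorff_space X \<and>
     (\<exists>\<B>. countable \<B> \<and> (\<forall>V\<in>\<B>. openin X V) \<and>
        (\<forall>U x. openin X U \<and> x \<in> U \<longrightarrow> (\<exists>V\<in>\<B>. x \<in> V \<and> V \<subseteq> U))) \<and>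
     (\<forall>x\<in>topspace X. \<exists>U V. openin X U \<and> x \<in> U \<and> openin (Euclidean_space n) V \<and>
        subtopology X U homeomorphic_space subtopology (Euclidean_space n) V)"

definition triangulation_of_manifold :: "nat \<Rightarrow> 'v set set \<Rightarrow> 'a topology \<Rightarrow> bool" where
  "triangulation_of_manifold n T X \<longleftrightarrow>
     topological_manifold n X \<and> abstract_simplicial_complex T \<and>
     realization T homeomorphic_space X"

section \<open>Euclidean, weighted and duality triangulations\<close>

text \<open>Functions on a set of simplices are represented as extensional functions, so that equality
  of functions is equality on the intended domain.\<close>

text \<open>The simplex \<open>\<sigma>\<close>, of dimension \<open>m = card \<sigma> - 1\<close>, is realized by affinely independent points
  \<open>p i\<close> (\<open>i \<in> \<sigma>\<close>) of \<open>m\<close>-dimensional Euclidean space; the coordinates of \<open>p i\<close> are \<open>p i a\<close> for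
  \<open>a < m\<close>. Explicit coordinates are used since the dimension varies with \<open>\<sigma>\<close>.\<close>

definition euclidean_realizable :: "'v set \<Rightarrow> ('v set \<Rightarrow> real) \<Rightarrow> bool" where
  "euclidean_realizable \<sigma> l \<longleftrightarrow>
     (\<exists>p :: 'v \<Rightarrow> nat \<Rightarrow> real.
        (\<forall>c. (\<Sum>i\<in>\<sigma>. c i) = 0 \<and> (\<forall>a<card \<sigma> - 1. (\<Sum>i\<in>\<sigma>. c i * p i a) = 0) \<longrightarrow> (\<forall>i\<in>\<sigma>. c i = 0)) \<and>
        (\<forall>i\<in>\<sigma>. \<forall>j\<in>\<sigma>. i \<noteq> j \<longrightarrow> L2_set (\<lambda>a. p i a - p j a) {..<card \<sigma> - 1} = l {i, j}))"

definition euclidean_triangulation :: "'v set set \<Rightarrow> ('v set \<Rightarrow> real) \<Rightarrow> bool" where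
  "euclidean_triangulation T l \<longleftrightarrow>
     l \<in> simplices T 1 \<rightarrow>\<^sub>E {0<..} \<and> (\<forall>\<sigma>\<in>T. euclidean_realizable \<sigma> l)"

definition weighted_triangulations :: "'v set set \<Rightarrow> (('v set \<Rightarrow> real) \<times> ('v \<Rightarrow> real)) set" where
  "weighted_triangulations T =
     {(l, w). euclidean_triangulation T l \<and> w \<in> vertices T \<rightarrow>\<^sub>E UNIV}"

definition weight_scaling ::
    "'v set set \<Rightarrow> ((('v set \<Rightarrow> real) \<times> ('v \<Rightarrow> real)) \<times> (('v set \<Rightarrow> real) \<times> ('v \<Rightarrow> real))) set" where
  "weight_scaling T =
     {((l, w), (l', w')). (l, w) \<in> weighted_triangulations T \<and>
        (l', w') \<in> weighted_triangulations T \<and>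
        l' = l \<and> (\<exists>t. \<forall>i\<in>vertices T. w' i = w i + t)}"

definition induced_length :: "'v set set \<Rightarrow> ('v \<times> 'v \<Rightarrow> real) \<Rightarrow> 'v set \<Rightarrow> real" where
  "induced_length T d =
     (\<lambda>e \<in> simplices T 1. \<Sum>(i, j) | (i, j) \<in> directed_edges T \<and> {i, j} = e. d (i, j))"

lemma induced_length_edge:
  assumes "(i, j) \<in> directed_edges T"
  shows "induced_length T d {i, j} = d (i, j) + d (j, i)"
proof -
  from assms have ij: "i \<noteq> j" "{i, j} \<in> simplices T 1" "{j, i} \<in> simplices T 1"
    by (auto simp: directed_edges_iff simplices_def insert_commute)
  have "{(a, b). (a, b) \<in> directed_edges T \<and> {a, b} = {i, j}} = {(i, j), (j, i)}"
    using ij by (auto simp: directed_edges_def doubleton_eq_iff)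
  with ij show ?thesis
    by (simp add: induced_length_def)
qed

definition duality_triangulations :: "'v set set \<Rightarrow> ('v \<times> 'v \<Rightarrow> real) set" where
  "duality_triangulations T =
     {d \<in> directed_edges T \<rightarrow>\<^sub>E UNIV.
        (\<forall>i j k. {i, j, k} \<in> simplices T 2 \<longrightarrow>
           (d (i, j))\<^sup>2 + (d (j, k))\<^sup>2 + (d (k, i))\<^sup>2 = (d (j, i))\<^sup>2 + (d (i, k))\<^sup>2 + (d (k, j))\<^sup>2) \<and>
        euclidean_triangulation T (induced_length T d)}"

definition duality_of_weighted ::
    "'v set set \<Rightarrow> ('v set \<Rightarrow> real) \<times> ('v \<Rightarrow> real) \<Rightarrow> 'v \<times> 'v \<Rightarrow> real" where
  "duality_of_weighted T = (\<lambda>(l, w).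
     \<lambda>(i, j) \<in> directed_edges T. ((l {i, j})\<^sup>2 + w i - w j) / (2 * l {i, j}))"

end

theory Submission
  imports Defs
begin

text \<open>With \<open>d\<^sub>i\<^sub>j = (\<ell>\<^sub>i\<^sub>j\<^sup>2 + w\<^sub>i - w\<^sub>j) / (2 \<ell>\<^sub>i\<^sub>j)\<close> one has \<open>d\<^sub>i\<^sub>j + d\<^sub>j\<^sub>i = \<ell>\<^sub>i\<^sub>j\<close> and
  \<open>d\<^sub>i\<^sub>j\<^sup>2 - d\<^sub>j\<^sub>i\<^sup>2 = w\<^sub>i - w\<^sub>j\<close>. So a duality triangulation is a choice of lengths together with a real
  1-cocycle \<open>\<alpha>\<^sub>i\<^sub>j = d\<^sub>i\<^sub>j\<^sup>2 - d\<^sub>j\<^sub>i\<^sup>2\<close>, and weights are potentials of \<open>\<alpha>\<close>. Connectedness makes a potential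
  unique up to a constant. For its existence, the sum of \<open>\<alpha>\<close> along a closed edge walk must vanish:
  realize the walk as a loop, contract it, and cut the homotopy square into \<open>N\<^sup>2\<close> cells, each mapped into
  the open star of some vertex. The labels of cells sharing a corner span a simplex, so by the
  cocycle condition the cyclic sum of \<open>\<alpha>\<close> along a row of labels is the same for all rows; it is
  the sum along the walk for the first row and \<open>0\<close> for the last.\<close>

section \<open>Simplices and open stars in the realization\<close>

lemma simplex_face:
  assumes "abstract_simplicial_complex T" "\<sigma> \<in> T" "\<tau> \<subseteq> \<sigma>" "\<tau> \<noteq> {}"
  shows "\<tau> \<in> T"
  using assms unfolding abstract_simplicial_complex_def by metis

lemma edge_endpoints:
  assumes "abstract_simplicial_complex T" "{i, j} \<in> T"
  shows "{i} \<in> T" "{j} \<in> T"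
  by (rule simplex_face[OF assms]; simp)+

text \<open>Each coordinate is continuous in the product topology, so its positivity is an open
  condition on every face. With \<open>C = {v}\<close> this is the open star of \<open>v\<close>;
  the connectedness argument needs unions over many vertices.\<close>

lemma openin_realization_stars:
  "openin (realization T) {x \<in> realization_points T. \<exists>v\<in>C. 0 < x v}"
  unfolding openin_realization
proof (intro conjI ballI)
  fix \<sigma>
  have "open {x :: 'a \<Rightarrow> real. 0 < x v}" for v
    by (intro open_Collect_less continuous_on_const continuous_on_product_coordinates)
  then have "open (\<Union>v\<in>C. {x :: 'a \<Rightarrow> real. 0 < x v})"
    by blast
  moreover have "{x \<in> realization_points T. \<exists>v\<in>C. 0 < x v} \<inter> realization_face T \<sigma> =
      realization_face T \<sigma> \<inter> (\<Union>v\<in>C. {x. 0 < x v})"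
    by (auto simp: realization_face_def)
  ultimately show "openin (top_of_set (realization_face T \<sigma>))
      ({x \<in> realization_points T. \<exists>v\<in>C. 0 < x v} \<inter> realization_face T \<sigma>)"
    by (simp add: openin_open_Int)
qed auto

lemma realization_point_positive:
  assumes "abstract_simplicial_complex T" "x \<in> realization_points T"
  obtains v where "0 < x v" "{v} \<in> T"
proof -
  have supp: "{v. x v \<noteq> 0} \<in> T"
    using assms(2) by (simp add: realization_points_def)
  then have "{v. x v \<noteq> 0} \<noteq> {}"
    using assms(1) by (metis abstract_simplicial_complex_def)
  then obtain v where "x v \<noteq> 0"
    by blast
  then have "{v} \<in> T"
    using simplex_face[OF assms(1) supp, of "{v}"] by blast
  moreover have "0 \<le> x v"
    using assms(2) by (simp add: realization_points_def)
  then have "0 < x v"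
    using \<open>x v \<noteq> 0\<close> by linarith
  ultimately show thesis
    using that by blast
qed

text \<open>The support of \<open>x\<close> is a simplex and \<open>\<sigma>\<close> is a face of
  it. Vertices whose open stars share a point therefore span a simplex, which is how the simplices
  of the grid argument arise.\<close>

lemma positive_coordinates_simplex:
  assumes "abstract_simplicial_complex T" "x \<in> realization_points T"
    and "\<And>v. v \<in> \<sigma> \<Longrightarrow> 0 < x v" "\<sigma> \<noteq> {}"
  shows "\<sigma> \<in> T"
proof -
  have "{v. x v \<noteq> 0} \<in> T"
    using assms(2) by (simp add: realization_points_def)
  moreover have "\<sigma> \<subseteq> {v. x v \<noteq> 0}"
    using assms(3) by fastforce
  ultimately show ?thesis
    using simplex_face[OF assms(1)] assms(4) by blast
qed

text \<open>A coordinate sum of \<open>1\<close> over \<open>\<sigma>\<close> forces a nonempty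
  support, which is then a face of \<open>\<sigma>\<close>. Summing over the fixed set
  \<open>\<sigma>\<close> instead of the varying support makes the conditions visibly
  closed.\<close>

lemma realization_face_eq:
  assumes "abstract_simplicial_complex T" "\<sigma> \<in> T"
  shows "realization_face T \<sigma> = {x. (\<forall>v. 0 \<le> x v) \<and> (\<forall>v. v \<notin> \<sigma> \<longrightarrow> x v = 0) \<and> (\<Sum>v\<in>\<sigma>. x v) = 1}"
    (is "_ = ?R")
proof (intro set_eqI)
  fix x :: "'a \<Rightarrow> real"
  have fin: "finite \<sigma>"
    using assms unfolding abstract_simplicial_complex_def by metis
  have eq: "(\<Sum>v | x v \<noteq> 0. x v) = (\<Sum>v\<in>\<sigma>. x v)" if "{v. x v \<noteq> 0} \<subseteq> \<sigma>"
    by (rule sum.mono_neutral_left) (use fin that in auto)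
  have "{v. x v \<noteq> 0} \<in> T" if "{v. x v \<noteq> 0} \<subseteq> \<sigma>" "(\<Sum>v\<in>\<sigma>. x v) = 1"
  proof -
    have "{v. x v \<noteq> 0} \<noteq> {}"
      using that(2) by (metis (mono_tags, lifting) empty_Collect_eq sum.neutral zero_neq_one)
    then show ?thesis
      using simplex_face[OF assms] that(1) by blast
  qed
  moreover have "{v. x v \<noteq> 0} \<subseteq> \<sigma> \<longleftrightarrow> (\<forall>v. v \<notin> \<sigma> \<longrightarrow> x v = 0)"
    by auto
  ultimately show "x \<in> realization_face T \<sigma> \<longleftrightarrow> x \<in> ?R"
    unfolding realization_face_def realization_points_def mem_Collect_eq using eq by metis
qed

lemma closed_realization_face:
  assumes "abstract_simplicial_complex T" "\<sigma> \<in> T"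
  shows "closed (realization_face T \<sigma>)"
  unfolding realization_face_eq[OF assms]
proof (intro closed_Collect_conj closed_Collect_all)
  show "closed {x :: 'a \<Rightarrow> real. 0 \<le> x v}" for v
    by (intro closed_Collect_le continuous_intros continuous_on_product_coordinates)
  show "closed {x :: 'a \<Rightarrow> real. v \<notin> \<sigma> \<longrightarrow> x v = 0}" for v
    by (cases "v \<in> \<sigma>")
      (auto intro!: closed_Collect_eq continuous_on_const continuous_on_product_coordinates)
  show "closed {x :: 'a \<Rightarrow> real. (\<Sum>v\<in>\<sigma>. x v) = 1}"
    by (intro closed_Collect_eq continuous_on_sum continuous_on_const continuous_on_product_coordinates)
qed

text \<open>The weak topology agrees with the product topology on finite subcomplexes.\<close>

lemma continuous_map_into_realization:
  fixes g :: "'b::topological_space \<Rightarrow> 'v \<Rightarrow> real"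
  assumes T: "abstract_simplicial_complex T" and F: "finite F" "F \<subseteq> T"
    and cont: "continuous_on S g"
    and im: "\<And>t. t \<in> S \<Longrightarrow> \<exists>\<sigma>\<in>F. g t \<in> realization_face T \<sigma>"
  shows "continuous_map (top_of_set S) (realization T) g"
  unfolding continuous_map_closedin
proof (intro conjI allI impI)
  show "g \<in> topspace (top_of_set S) \<rightarrow> topspace (realization T)"
    using im by (auto simp: topspace_realization realization_face_def)
  fix C
  assume C: "closedin (realization T) C"
  have "closed (C \<inter> realization_face T \<sigma>)" if "\<sigma> \<in> F" for \<sigma>
  proof -
    have "\<sigma> \<in> T"
      using that F by blast
    have "openin (realization T) (realization_points T - C)"
      using C by (simp add: closedin_def topspace_realization)
    then have "openin (top_of_set (realization_face T \<sigma>))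
        ((realization_points T - C) \<inter> realization_face T \<sigma>)"
      using \<open>\<sigma> \<in> T\<close> by (simp add: openin_realization)
    moreover have "(realization_points T - C) \<inter> realization_face T \<sigma>
        = realization_face T \<sigma> - C \<inter> realization_face T \<sigma>"
      by (auto simp: realization_face_def)
    ultimately have "closedin (top_of_set (realization_face T \<sigma>)) (C \<inter> realization_face T \<sigma>)"
      by (simp add: closedin_def)
    then show ?thesis
      using closed_realization_face[OF T \<open>\<sigma> \<in> T\<close>] closedin_closed_trans by blast
  qed
  \<comment> \<open>Finiteness of \<open>F\<close> enters here: the weak topology controls one face
    at a time, and a finite union of the closed traces is again closed.\<close>
  then have "closed (\<Union>\<sigma>\<in>F. C \<inter> realization_face T \<sigma>)"
    using F by blast
  then have "closedin (top_of_set S) (S \<inter> g -` (\<Union>\<sigma>\<in>F. C \<inter> realization_face T \<sigma>))"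
    using cont continuous_closedin_preimage by blast
  moreover have "S \<inter> g -` (\<Union>\<sigma>\<in>F. C \<inter> realization_face T \<sigma>) = {t \<in> topspace (top_of_set S). g t \<in> C}"
    using im by auto
  ultimately show "closedin (top_of_set S) {t \<in> topspace (top_of_set S). g t \<in> C}"
    by simp
qed

section \<open>Edge walks as piecewise linear paths\<close>

text \<open>The path that is at \<open>u k\<close> at time \<open>k\<close> and moves linearly in
  between, written with a hat function around each integer time. Summing over \<open>k\<close>
  allows vertices to recur, and continuity can be read off each coordinate.\<close>

definition edge_path :: "(nat \<Rightarrow> 'v) \<Rightarrow> nat \<Rightarrow> real \<Rightarrow> 'v \<Rightarrow> real" where
  "edge_path u m t v = (\<Sum>k\<le>m. if u k = v then max 0 (1 - \<bar>t - real k\<bar>) else 0)"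

lemma continuous_on_edge_path: "continuous_on S (edge_path u m)"
proof (rule continuous_on_coordinatewise_then_product)
  fix v
  have "continuous_on S (\<lambda>t. if u k = v then max 0 (1 - \<bar>t - real k\<bar>) else 0)" for k
    by (cases "u k = v") (auto intro!: continuous_intros)
  then show "continuous_on S (\<lambda>t. edge_path u m t v)"
    unfolding edge_path_def by (intro continuous_on_sum) auto
qed

text \<open>All summands are nonnegative and the hat around \<open>k\<close> is positive, so at
  these times the path is in the open star of \<open>u k\<close>.\<close>

lemma edge_path_pos:
  assumes "k \<le> m" "\<bar>t - real k\<bar> < 1"
  shows "0 < edge_path u m t (u k)"
proof -
  have "0 < (if u k = u k then max 0 (1 - \<bar>t - real k\<bar>) else 0)"
    using assms by simp
  also have "\<dots> \<le> edge_path u m t (u k)"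
    unfolding edge_path_def using assms(1)
    by (intro member_le_sum[where f = "\<lambda>j. if u j = u k then max 0 (1 - \<bar>t - real j\<bar>) else 0"]) auto
  finally show ?thesis .
qed

text \<open>Every hat other than those around \<open>k\<close> and \<open>Suc k\<close> has its
  centre at distance at least \<open>1\<close> from \<open>t\<close> and vanishes.\<close>

lemma edge_path_on_edge:
  assumes "k < m" "real k \<le> t" "t \<le> real (Suc k)"
  shows "edge_path u m t v =
    (if u k = v then 1 - (t - real k) else 0) + (if u (Suc k) = v then t - real k else 0)"
proof -
  have "edge_path u m t v = (\<Sum>j\<in>{k, Suc k}. if u j = v then max 0 (1 - \<bar>t - real j\<bar>) else 0)"
    unfolding edge_path_def
  proof (rule sum.mono_neutral_right)
    show "\<forall>j\<in>{..m} - {k, Suc k}. (if u j = v then max 0 (1 - \<bar>t - real j\<bar>) else 0) = 0"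
    proof
      fix j assume "j \<in> {..m} - {k, Suc k}"
      then have "j < k \<or> Suc k < j"
        by auto
      then have "real j + 1 \<le> real k \<or> real (Suc k) + 1 \<le> real j"
        by linarith
      then show "(if u j = v then max 0 (1 - \<bar>t - real j\<bar>) else 0) = 0"
        using assms by auto
    qed
  qed (use assms in auto)
  then show ?thesis
    using assms by auto
qed

lemma edge_path_in_face:
  assumes T: "abstract_simplicial_complex T" and e: "{u k, u (Suc k)} \<in> T"
    and k: "k < m" "real k \<le> t" "t \<le> real (Suc k)"
  shows "edge_path u m t \<in> realization_face T {u k, u (Suc k)}"
  unfolding realization_face_eq[OF T e]
proof (intro CollectI conjI allI impI)
  note eq = edge_path_on_edge[OF k, of u]
  show "0 \<le> edge_path u m t v" for v
    unfolding eq using k by simp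
  show "edge_path u m t v = 0" if "v \<notin> {u k, u (Suc k)}" for v
    unfolding eq using that by auto
  show "(\<Sum>v\<in>{u k, u (Suc k)}. edge_path u m t v) = 1"
    unfolding eq by (cases "u k = u (Suc k)") auto
qed

lemma edge_path_0: "edge_path u m 0 v = (if u 0 = v then 1 else 0)"
proof -
  have "edge_path u m 0 v = (\<Sum>k\<in>{0}. if u k = v then max 0 (1 - \<bar>0 - real k\<bar>) else 0)"
    unfolding edge_path_def by (rule sum.mono_neutral_right) auto
  then show ?thesis by simp
qed

lemma edge_path_end: "edge_path u m (real m) v = (if u m = v then 1 else 0)"
proof -
  have "edge_path u m (real m) v = (\<Sum>k\<in>{m}. if u k = v then max 0 (1 - \<bar>real m - real k\<bar>) else 0)"
    unfolding edge_path_def by (rule sum.mono_neutral_right) auto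
  then show ?thesis by simp
qed

lemma continuous_map_edge_path:
  assumes T: "abstract_simplicial_complex T" and "0 < m"
    and e: "\<And>k. k < m \<Longrightarrow> {u k, u (Suc k)} \<in> T"
  shows "continuous_map (top_of_set {0..real m}) (realization T) (edge_path u m)"
proof (rule continuous_map_into_realization[OF T, of "(\<lambda>k. {u k, u (Suc k)}) ` {..<m}"])
  fix t assume t: "t \<in> {0..real m}"
  obtain k where "k < m" "real k \<le> t" "t \<le> real (Suc k)"
  proof (cases "t = real m")
    \<comment> \<open>At the right end the floor of \<open>t\<close> is \<open>m\<close>, where no
      edge starts, so the last edge is used.\<close>
    case True
    then show thesis
      using that[of "m - 1"] \<open>0 < m\<close> by auto
  next
    case False
    have "nat \<lfloor>t\<rfloor> < m" "real (nat \<lfloor>t\<rfloor>) \<le> t" "t \<le> real (Suc (nat \<lfloor>t\<rfloor>))"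
      using t False by (auto simp: nat_less_iff floor_less_iff) linarith+
    then show thesis
      using that by blast
  qed
  then show "\<exists>\<sigma>\<in>(\<lambda>k. {u k, u (Suc k)}) ` {..<m}. edge_path u m t \<in> realization_face T \<sigma>"
    using edge_path_in_face[OF T e[of k], of m t] by blast
qed (use e continuous_on_edge_path in auto)

section \<open>Cocycles and their sums along closed sequences\<close>

text \<open>Degenerate triples are included on purpose: they give \<open>\<alpha> i i = 0\<close>
  and antisymmetry, and let a walk pause at a vertex.\<close>

definition cocycle :: "'v set set \<Rightarrow> ('v \<Rightarrow> 'v \<Rightarrow> real) \<Rightarrow> bool" where
  "cocycle T \<alpha> \<longleftrightarrow> (\<forall>i j k. {i, j, k} \<in> T \<longrightarrow> \<alpha> i j + \<alpha> j k = \<alpha> i k)"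

lemma cocycleD: "cocycle T \<alpha> \<Longrightarrow> {i, j, k} \<in> T \<Longrightarrow> \<alpha> i j + \<alpha> j k = \<alpha> i k"
  by (simp add: cocycle_def)

lemma cocycle_refl: "cocycle T \<alpha> \<Longrightarrow> {i} \<in> T \<Longrightarrow> \<alpha> i i = 0"
  using cocycleD[of T \<alpha> i i i] by simp

lemma cocycle_sym:
  assumes "abstract_simplicial_complex T" "cocycle T \<alpha>" "{i, j} \<in> T"
  shows "\<alpha> j i = - \<alpha> i j"
proof -
  have "{i} \<in> T"
    using edge_endpoints assms(1,3) by metis
  moreover have "{i, j, i} \<in> T"
    using assms(3) by (simp add: insert_commute)
  ultimately show ?thesis
    using cocycleD[OF assms(2), of i j i] cocycle_refl[OF assms(2), of i] by simp
qed

text \<open>Both ways from \<open>r b\<close> to \<open>s (Suc b)\<close>, through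
  \<open>r (Suc b)\<close> or through \<open>s b\<close>, have the same sum. The two sums thus
  differ by terms on the cross edges from \<open>r b\<close> to \<open>s b\<close>, which telescope
  and cancel because both sequences are closed.\<close>

lemma cocycle_sum_eq:
  fixes r s :: "nat \<Rightarrow> 'v"
  assumes T: "abstract_simplicial_complex T" and \<alpha>: "cocycle T \<alpha>"
    and rs: "\<And>b. b < N \<Longrightarrow> {r b, r (Suc b), s b, s (Suc b)} \<in> T"
    and closed: "r N = r 0" "s N = s 0"
  shows "(\<Sum>b<N. \<alpha> (r b) (r (Suc b))) = (\<Sum>b<N. \<alpha> (s b) (s (Suc b)))"
proof -
  have "\<alpha> (r b) (r (Suc b)) - \<alpha> (s b) (s (Suc b)) = \<alpha> (r b) (s b) - \<alpha> (r (Suc b)) (s (Suc b))"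
    if "b < N" for b
  proof -
    have sub: "\<tau> \<in> T" if "\<tau> \<subseteq> {r b, r (Suc b), s b, s (Suc b)}" "\<tau> \<noteq> {}" for \<tau>
      using simplex_face[OF T rs[OF \<open>b < N\<close>] that] .
    have "\<alpha> (r b) (r (Suc b)) + \<alpha> (r (Suc b)) (s (Suc b)) = \<alpha> (r b) (s (Suc b))"
      "\<alpha> (r b) (s b) + \<alpha> (s b) (s (Suc b)) = \<alpha> (r b) (s (Suc b))"
      by (rule cocycleD[OF \<alpha>], rule sub; blast)+
    then show ?thesis by simp
  qed
  then have "(\<Sum>b<N. \<alpha> (r b) (r (Suc b)) - \<alpha> (s b) (s (Suc b)))
      = (\<Sum>b<N. \<alpha> (r b) (s b) - \<alpha> (r (Suc b)) (s (Suc b)))"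
    by (intro sum.cong) auto
  also have "\<dots> = 0"
    using closed sum_lessThan_telescope'[of "\<lambda>b. \<alpha> (r b) (s b)" N] by simp
  finally show ?thesis
    by (simp add: sum_subtractf)
qed

text \<open>\<open>f\<close> is a staircase: a rise yields the next edge of the walk, a flat step
  contributes \<open>0\<close>.\<close>

lemma sum_reparametrize:
  fixes \<alpha> :: "'v \<Rightarrow> 'v \<Rightarrow> real"
  assumes "f 0 = 0" "\<And>b. f (Suc b) = f b \<or> f (Suc b) = Suc (f b)" "\<And>b. b < n \<Longrightarrow> \<alpha> (u (f b)) (u (f b)) = 0"
  shows "(\<Sum>b<n. \<alpha> (u (f b)) (u (f (Suc b)))) = (\<Sum>k<f n. \<alpha> (u k) (u (Suc k)))"
  using assms(3)
proof (induction n)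
  case (Suc n)
  then show ?case
    using assms(2)[of n] by (elim disjE) auto
qed (simp add: assms(1))

section \<open>Subdivision of the homotopy square\<close>

lemma grid_stars:
  fixes G :: "real \<times> real \<Rightarrow> 'v \<Rightarrow> real"
  assumes T: "abstract_simplicial_complex T"
    and G: "continuous_map (top_of_set ({0..1} \<times> {0..1})) (realization T) G"
  obtains K0 where "\<And>N. K0 \<le> N \<Longrightarrow> 0 < N \<Longrightarrow> \<exists>i :: nat \<Rightarrow> nat \<Rightarrow> 'v. \<forall>a<N. \<forall>b<N.
     \<forall>x \<in> {real a / N..real (Suc a) / N} \<times> {real b / N..real (Suc b) / N}. 0 < G x (i a b)"
proof -
  let ?S = "{0..1::real} \<times> {0..1::real}"
  have ptsG: "G x \<in> realization_points T" if "x \<in> ?S" for x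
    using continuous_map_image_subset_topspace[OF G] that
    by (auto simp: topspace_realization)
  have "\<exists>W. open W \<and> {x \<in> ?S. 0 < G x v} = ?S \<inter> W" for v
  proof -
    have "openin (top_of_set ?S) {x \<in> topspace (top_of_set ?S). G x \<in> {x \<in> realization_points T. \<exists>w\<in>{v}. 0 < x w}}"
      by (rule openin_continuous_map_preimage[OF G openin_realization_stars])
    also have "{x \<in> topspace (top_of_set ?S). G x \<in> {x \<in> realization_points T. \<exists>w\<in>{v}. 0 < x w}}
        = {x \<in> ?S. 0 < G x v}"
      using ptsG by auto
    finally show ?thesis
      by (simp add: openin_open)
  qed
  then obtain W where W: "\<And>v. open (W v)" "\<And>v. {x \<in> ?S. 0 < G x v} = ?S \<inter> W v"
    by metis
  have cover: "?S \<subseteq> \<Union>(range W)"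
  proof
    fix x assume x: "x \<in> ?S"
    obtain v where "0 < G x v"
      using realization_point_positive[OF T ptsG[OF x]] by blast
    then show "x \<in> \<Union>(range W)"
      using W(2)[of v] x by blast
  qed
  have "compact ?S"
    by (intro compact_Times compact_Icc)
  then obtain \<delta> where \<delta>: "0 < \<delta>"
    and leb: "\<And>Q. Q \<subseteq> ?S \<Longrightarrow> diameter Q < \<delta> \<Longrightarrow> \<exists>B\<in>range W. Q \<subseteq> B"
    using Lebesgue_number_lemma[of ?S "range W"] cover W(1) by blast
  \<comment> \<open>A cell has diameter at most \<open>2 / N\<close>, and this threshold pushes it
    below \<open>\<delta>\<close>.\<close>
  obtain K0 :: nat where K0: "2 / \<delta> < real K0"
    using reals_Archimedean2 by blast
  show thesis
  proof (rule that[of K0])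
    fix N :: nat assume N: "K0 \<le> N" "0 < N"
    have "\<exists>v. \<forall>x\<in>{real a / N..real (Suc a) / N} \<times> {real b / N..real (Suc b) / N}. 0 < G x v"
      if ab: "a < N" "b < N" for a b
    proof -
      let ?Q = "{real a / N..real (Suc a) / N} \<times> {real b / N..real (Suc b) / N}"
      have "real (Suc c) / N \<le> 1" if "c < N" for c
        using that by simp
      then have QS: "?Q \<subseteq> ?S"
        using ab by (intro Sigma_mono) auto
      have step: "real (Suc c) / N - real c / N = 1 / N" for c
        by (simp add: diff_divide_distrib[symmetric])
      have "diameter ?Q \<le> 2 / N"
      proof (rule diameter_le)
        fix x y assume "x \<in> ?Q" "y \<in> ?Q"
        then have "\<bar>fst x - fst y\<bar> \<le> 1 / N" "\<bar>snd x - snd y\<bar> \<le> 1 / N"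
          using step[of a] step[of b] by (auto simp: mem_Times_iff abs_le_iff)
        moreover have "norm (x - y) \<le> \<bar>fst x - fst y\<bar> + \<bar>snd x - snd y\<bar>"
          using norm_Pair_le[of "fst (x - y)" "snd (x - y)"] unfolding prod.collapse by simp
        ultimately show "norm (x - y) \<le> 2 / N"
          by simp
      qed simp
      also have "2 / N < \<delta>"
      proof -
        have "2 / \<delta> < real N"
          using K0 N by linarith
        then show ?thesis
          using \<delta> N by (simp add: field_simps)
      qed
      finally obtain v where "?Q \<subseteq> W v"
        using leb[OF QS] by blast
      then show ?thesis
        using QS W(2)[of v] by blast
    qed
    then show "\<exists>i :: nat \<Rightarrow> nat \<Rightarrow> 'v. \<forall>a<N. \<forall>b<N.
        \<forall>x \<in> {real a / N..real (Suc a) / N} \<times> {real b / N..real (Suc b) / N}. 0 < G x (i a b)"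
      by metis
  qed
qed

section \<open>Cocycle sums along closed edge walks\<close>

text \<open>Simple connectedness is given for \<open>M\<close>, so the edge loop is carried to
  \<open>M\<close> by \<open>\<phi>\<close>, contracted there, and the homotopy is brought back by
  \<open>\<psi>\<close>.\<close>

lemma cocycle_sum_loop:
  fixes M :: "'a::topological_space set" and T :: "'v set set"
  assumes T: "abstract_simplicial_complex T" and \<alpha>: "cocycle T \<alpha>"
    and homeo: "realization T homeomorphic_space top_of_set M" and sc: "simply_connected M"
    and e: "\<And>k. k < m \<Longrightarrow> {u k, u (Suc k)} \<in> T" and loop: "u m = u 0"
  shows "(\<Sum>k<m. \<alpha> (u k) (u (Suc k))) = 0"
proof (cases "m = 0")
  case False
  then have m: "0 < m" by simp
  obtain \<phi> \<psi> where \<phi>: "continuous_map (realization T) (top_of_set M) \<phi>"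
    and \<psi>: "continuous_map (top_of_set M) (realization T) \<psi>"
    and \<psi>\<phi>: "\<And>x. x \<in> realization_points T \<Longrightarrow> \<psi> (\<phi> x) = x"
    using homeo by (auto simp: homeomorphic_space_def homeomorphic_maps_def topspace_realization)
  have E: "continuous_map (top_of_set {0..1}) (realization T) (\<lambda>t. edge_path u m (real m * t))"
  proof -
    have "continuous_map (top_of_set {0..1}) (top_of_set {0..real m}) (\<lambda>t. real m * t)"
      using m by (auto simp: continuous_map_in_subtopology mult_left_le intro!: continuous_intros)
    from continuous_map_compose[OF this continuous_map_edge_path[where u = u, OF T m e]]
    show ?thesis by (simp add: o_def)
  qed
  have E_pts: "edge_path u m (real m * t) \<in> realization_points T" if "t \<in> {0..1}" for t
    using continuous_map_image_subset_topspace[OF E] that by (auto simp: topspace_realization)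
  define p where "p t = \<phi> (edge_path u m (real m * t))" for t
  have "continuous_map (top_of_set {0..1}) (top_of_set M) p"
    using continuous_map_compose[OF E \<phi>] by (simp add: o_def p_def[abs_def])
  then have p: "path p" "path_image p \<subseteq> M"
    by (auto simp: path_def path_image_def continuous_map_in_subtopology)
  have ends: "edge_path u m (real m) = edge_path u m 0"
    by (rule ext) (simp add: edge_path_0 edge_path_end loop)
  have "p 0 \<in> M"
    using p(2) by (auto simp: path_image_def)
  then have "path (\<lambda>_. p 0)" "path_image (\<lambda>_. p 0) \<subseteq> M"
    by (auto simp: path_def path_image_def)
  moreover have "pathfinish p = pathstart p"
    by (simp add: p_def pathfinish_def pathstart_def ends)
  ultimately have "homotopic_loops M p (\<lambda>_. p 0)"
    using sc p by (simp add: simply_connected_def pathfinish_def pathstart_def)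
  \<comment> \<open>The homotopy is free: each loop \<open>H (s, _)\<close> closes up, but its base
    point may move with \<open>s\<close>.\<close>
  then obtain H where H: "continuous_on ({0..1::real} \<times> {0..1}) H" "H \<in> {0..1} \<times> {0..1} \<rightarrow> M"
    and H0: "\<And>t. t \<in> {0..1} \<Longrightarrow> H (0, t) = p t" and H1: "\<And>t. t \<in> {0..1} \<Longrightarrow> H (1, t) = p 0"
    and Hl: "\<And>s. s \<in> {0..1} \<Longrightarrow> H (s, 1) = H (s, 0)"
    by (auto simp: homotopic_loops pathfinish_def pathstart_def)
  define G where "G = \<psi> \<circ> H"
  have "continuous_map (top_of_set ({0..1} \<times> {0..1})) (top_of_set M) H"
    using H by (auto simp: continuous_map_in_subtopology)
  then have G: "continuous_map (top_of_set ({0..1} \<times> {0..1})) (realization T) G"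
    unfolding G_def using \<psi> by (rule continuous_map_compose)
  have G_pts: "G (s, t) \<in> realization_points T" if "s \<in> {0..1}" "t \<in> {0..1}" for s t
    using continuous_map_image_subset_topspace[OF G] that by (auto simp: topspace_realization)
  have G0: "G (0, t) = edge_path u m (real m * t)" if "t \<in> {0..1}" for t
    using that H0 \<psi>\<phi>[OF E_pts] by (simp add: G_def p_def)
  have G1: "G (1, t) = edge_path u m 0" if "t \<in> {0..1}" for t
    using that H1 \<psi>\<phi>[OF E_pts[of 0]] by (simp add: G_def p_def)
  have Gl: "G (s, 1) = G (s, 0)" if "s \<in> {0..1}" for s
    using that Hl by (simp add: G_def)

  obtain K0 where K0: "\<And>N. K0 \<le> N \<Longrightarrow> 0 < N \<Longrightarrow> \<exists>i :: nat \<Rightarrow> nat \<Rightarrow> 'v. \<forall>a<N. \<forall>b<N.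
     \<forall>x \<in> {real a / N..real (Suc a) / N} \<times> {real b / N..real (Suc b) / N}. 0 < G x (i a b)"
    using grid_stars[OF T G] by blast
  \<comment> \<open>\<open>K\<close> is positive and exceeds the threshold \<open>K0\<close>. Each
    unit of walk time gets the even number \<open>2 * K\<close> of cells, so that rounding to the
    nearest vertex is an integer division after a shift by \<open>K\<close>.\<close>
  define K where "K = Suc K0"
  define N where "N = 2 * K * m"
  have K: "0 < K" and "0 < N"
    using m by (auto simp: K_def N_def)
  moreover have "K0 \<le> N"
    unfolding N_def using mult_le_mono[of K0 "2 * K" 1 m] m by (simp add: K_def)
  ultimately have N: "0 < N" "K0 \<le> N"
    by auto
  obtain i :: "nat \<Rightarrow> nat \<Rightarrow> 'v" where "\<forall>a<N. \<forall>b<N.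
     \<forall>x \<in> {real a / N..real (Suc a) / N} \<times> {real b / N..real (Suc b) / N}. 0 < G x (i a b)"
    using K0[OF N(2,1)] by blast
  then have i: "\<And>a b s t. \<lbrakk>a < N; b < N; real a / N \<le> s; s \<le> real (Suc a) / N;
      real b / N \<le> t; t \<le> real (Suc b) / N\<rbrakk> \<Longrightarrow> 0 < G (s, t) (i a b)"
    by (simp add: mem_Times_iff)
  \<comment> \<open>Labels are made periodic: column \<open>N\<close> is column \<open>0\<close>, as
    \<open>G\<close> agrees on the sides \<open>t = 0\<close> and \<open>t = 1\<close>.\<close>
  define r where "r a b = i a (b mod N)" for a b
  have unit: "real c / N \<in> {0..1}" if "c \<le> N" for c
    using that N by simp
  \<comment> \<open>The end \<open>Suc b / N\<close> of cell \<open>b\<close> is the start of the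
    next cell, so the labels of both are positive there. After the last cell comes cell
    \<open>0\<close>, by way of \<open>Gl\<close>.\<close>
  have r: "0 < G (s, real (Suc b) / N) (r a b)" "0 < G (s, real (Suc b) / N) (r a (Suc b))"
    if ab: "a < N" "b < N" and s: "real a / N \<le> s" "s \<le> real (Suc a) / N" for a b s
  proof -
    show "0 < G (s, real (Suc b) / N) (r a b)"
      using i[OF ab s] ab by (simp add: r_def divide_right_mono)
    show "0 < G (s, real (Suc b) / N) (r a (Suc b))"
    proof (cases "Suc b < N")
      case True
      then show ?thesis
        using i[OF ab(1) True s] by (simp add: r_def divide_right_mono)
    next
      case False
      then have "Suc b = N"
        using ab by simp
      moreover have "s \<in> {0..1}"
        using s unit[of a] unit[of "Suc a"] ab unfolding atLeastAtMost_iff by linarith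
      moreover have "0 < G (s, 0) (i a 0)"
        using i[OF ab(1) N(1) s, of 0] by simp
      ultimately show ?thesis
        using Gl N by (simp add: r_def)
    qed
  qed
  have rN: "r a N = r a 0" for a
    by (simp add: r_def)
  define S where "S a = (\<Sum>b<N. \<alpha> (r a b) (r a (Suc b)))" for a

  \<comment> \<open>The four labels belong to cells meeting in one corner of the grid (up to the
    identification of the two sides), so they are all positive at its image and span a
    simplex.\<close>
  have "S (Suc a) = S a" if a: "Suc a < N" for a
    unfolding S_def
  proof (rule cocycle_sum_eq[OF T \<alpha>])
    fix b assume b: "b < N"
    have s: "real a / N \<le> real (Suc a) / N" "real (Suc a) / N \<le> real (Suc (Suc a)) / N"
      by (simp_all add: divide_right_mono)
    have "G (real (Suc a) / N, real (Suc b) / N) \<in> realization_points T"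
      using a b by (intro G_pts unit) auto
    then show "{r (Suc a) b, r (Suc a) (Suc b), r a b, r a (Suc b)} \<in> T"
    proof (rule positive_coordinates_simplex[OF T])
      fix v assume "v \<in> {r (Suc a) b, r (Suc a) (Suc b), r a b, r a (Suc b)}"
      then show "0 < G (real (Suc a) / N, real (Suc b) / N) v"
        using r[OF Suc_lessD[OF a] b s(1) order_refl] r[OF a b order_refl s(2)] by blast
    qed simp
  qed (simp_all add: rN)
  then have "a < N \<Longrightarrow> S a = S 0" for a
    by (induction a) auto
  from this[of "N - 1"] have "S 0 = S (N - 1)"
    using N by simp
  \<comment> \<open>On the side \<open>s = 1\<close> the map \<open>G\<close> is constant, so all
    labels of the last row are positive at one point. This allows a comparison with the constant
    row.\<close>
  also have "S (N - 1) = (\<Sum>b<N. \<alpha> (r (N - 1) 0) (r (N - 1) 0))"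
    unfolding S_def
  proof (rule cocycle_sum_eq[OF T \<alpha>])
    fix b assume b: "b < N"
    have "real (N - 1) / N \<le> 1" "1 \<le> real (Suc (N - 1)) / N" "N - 1 < N"
      using N by auto
    note r1 = r[OF this(3) _ this(1,2)]
    have pos: "0 < edge_path u m 0 (r (N - 1) c)" if "c < N" for c
      using r1(1)[OF that] G1[OF unit[of "Suc c"]] that by simp
    have "0 < edge_path u m 0 (r (N - 1) (Suc b))"
      using r1(2)[OF b] G1[OF unit[of "Suc b"]] b by simp
    moreover have "edge_path u m 0 \<in> realization_points T"
      using E_pts[of 0] by simp
    ultimately show "{r (N - 1) b, r (N - 1) (Suc b), r (N - 1) 0, r (N - 1) 0} \<in> T"
      using pos[OF b] pos[OF N(1)] by (auto intro!: positive_coordinates_simplex[OF T])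
  qed (simp_all add: rN)
  also have "\<dots> = 0"
  proof -
    have "{r (N - 1) 0} \<in> T"
    proof (rule positive_coordinates_simplex[OF T G_pts[of "real (N - 1) / N" "real 0 / N"]])
      fix v assume "v \<in> {r (N - 1) 0}"
      then show "0 < G (real (N - 1) / N, real 0 / N) v"
        using i[of "N - 1" 0 "real (N - 1) / N" "real 0 / N"] N by (auto simp: r_def divide_right_mono)
    qed (use N in auto)
    then have "\<alpha> (r (N - 1) 0) (r (N - 1) 0) = 0"
      by (rule cocycle_refl[OF \<alpha>])
    then show ?thesis by simp
  qed
  finally have "S 0 = 0" .

  text \<open>The edge path at time \<open>b / N\<close> lies in the open star of the nearest vertex of the walk.\<close>
  define f where "f b = (b + K) div (2 * K)" for b
  have f_le: "f b \<le> m" if "b \<le> N" for b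
  proof -
    have "f b \<le> (N + K) div (2 * K)"
      using that by (simp add: f_def div_le_mono)
    also have "\<dots> = m"
      using K by (simp add: N_def)
    finally show ?thesis .
  qed
  \<comment> \<open>Rounding in integer form: \<open>b\<close> is at distance at most
    \<open>K\<close> from \<open>2 * K * f b\<close>.\<close>
  have f_bounds: "2 * real K * f b \<le> b + K" "b + K < 2 * real K * f b + 2 * K" for b
  proof -
    have "2 * K * f b \<le> b + K"
      by (simp add: f_def)
    then have "real (2 * K * f b) \<le> real (b + K)"
      by (rule of_nat_mono)
    then show "2 * real K * f b \<le> b + K"
      by simp
    have "b + K < 2 * K * f b + 2 * K"
      using K dividend_less_times_div[of "2 * K" "b + K"] by (simp add: f_def)
    then have "real (b + K) < real (2 * K * f b + 2 * K)"
      by (rule less_imp_of_nat_less)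
    then show "b + K < 2 * real K * f b + 2 * K"
      by simp
  qed
  have f0: "f 0 = 0" and fN: "f N = m"
    using K by (simp_all add: f_def N_def)
  \<comment> \<open>The four vertices compared here are all positive at the point
    \<open>G (0, Suc b / N)\<close> of the edge path.\<close>
  have "S 0 = (\<Sum>b<N. \<alpha> (u (f b)) (u (f (Suc b))))"
    unfolding S_def
  proof (rule cocycle_sum_eq[OF T \<alpha>])
    fix b assume b: "b < N"
    have K1: "1 \<le> real K"
      using K by linarith
    define \<tau> where "\<tau> = real (Suc b) / (2 * K)"
    have \<tau>: "real m * (real (Suc b) / N) = \<tau>"
      using m K by (simp add: \<tau>_def N_def field_simps)
    \<comment> \<open>The extra \<open>1\<close> in the second bound lets \<open>c = f b\<close> be
      used at time \<open>Suc b\<close>; it is absorbed by \<open>K + 1 \<le> 2 * K\<close>.\<close>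
    have "\<bar>\<tau> - real c\<bar> < 1"
      if "2 * real K * c \<le> real (Suc b) + K" "real (Suc b) + K < 2 * real K * c + 2 * K + 1" for c
    proof -
      have "2 * real K * \<tau> = real (Suc b)"
        using K by (simp add: \<tau>_def)
      then have "2 * real K * (\<tau> - c) < 2 * real K * 1" "2 * real K * - 1 < 2 * real K * (\<tau> - c)"
        using that K1 unfolding right_diff_distrib by linarith+
      then have "\<tau> - c < 1" "- 1 < \<tau> - c"
        using K1 by (simp_all only: mult_less_cancel_left_pos)
      then show ?thesis
        by (simp add: abs_less_iff)
    qed
    then have "\<bar>\<tau> - f b\<bar> < 1" "\<bar>\<tau> - f (Suc b)\<bar> < 1"
      using f_bounds[of b] f_bounds[of "Suc b"] by simp_all
    then have "0 < edge_path u m \<tau> (u (f b))" "0 < edge_path u m \<tau> (u (f (Suc b)))"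
      using f_le[of b] f_le[of "Suc b"] b by (auto intro!: edge_path_pos)
    moreover have "G (0, real (Suc b) / N) = edge_path u m \<tau>"
      using G0[OF unit[of "Suc b"]] b \<tau> by simp
    moreover have "0 < G (0, real (Suc b) / N) (r 0 b)" "0 < G (0, real (Suc b) / N) (r 0 (Suc b))"
      using r[of 0 b 0] b N by auto
    moreover have "G (0, real (Suc b) / N) \<in> realization_points T"
      using G_pts[OF _ unit[of "Suc b"], of 0] b by simp
    ultimately show "{r 0 b, r 0 (Suc b), u (f b), u (f (Suc b))} \<in> T"
      by (auto intro!: positive_coordinates_simplex[OF T] simp del: of_nat_Suc)
  qed (simp_all add: rN f0 fN loop)
  also have "\<dots> = (\<Sum>k<f N. \<alpha> (u k) (u (Suc k)))"
  proof (rule sum_reparametrize)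
    show "f (Suc b) = f b \<or> f (Suc b) = Suc (f b)" for b
      by (simp add: f_def div_Suc)
    \<comment> \<open>At the integer time \<open>f b\<close> the path is at \<open>u (f b)\<close>,
      which is thus a vertex, and a pause there contributes \<open>0\<close>.\<close>
    fix b assume "b < N"
    then have "edge_path u m (real (f b)) \<in> realization_points T" "0 < edge_path u m (real (f b)) (u (f b))"
      using E_pts[of "f b / m"] f_le[of b] m edge_path_pos[of "f b" m "f b"] by auto
    then have "{u (f b)} \<in> T"
      using positive_coordinates_simplex[OF T, of _ "{u (f b)}"] by blast
    then show "\<alpha> (u (f b)) (u (f b)) = 0"
      by (rule cocycle_refl[OF \<alpha>])
  qed (rule f0)
  finally show ?thesis
    using \<open>S 0 = 0\<close> fN by simp
qed simp

section \<open>Walks and potentials\<close>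

text \<open>The last argument records the sum of \<open>\<alpha>\<close> along the walk. It is a
  relation because different walks between the same ends may at first have different sums.\<close>

inductive walk :: "'v set set \<Rightarrow> ('v \<Rightarrow> 'v \<Rightarrow> real) \<Rightarrow> 'v \<Rightarrow> 'v \<Rightarrow> real \<Rightarrow> bool"
  for T \<alpha> where
  refl: "walk T \<alpha> x x 0"
| step: "walk T \<alpha> x y s \<Longrightarrow> {y, z} \<in> T \<Longrightarrow> walk T \<alpha> x z (s + \<alpha> y z)"

lemma walk_trans: "walk T \<alpha> y z t \<Longrightarrow> walk T \<alpha> x y s \<Longrightarrow> walk T \<alpha> x z (s + t)"
proof (induction rule: walk.induct)
  case (step y y' t z)
  then show ?case
    using walk.step[of T \<alpha> x y' "s + t" z] by (simp add: add.assoc)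
qed simp

lemma walk_edge: "{y, z} \<in> T \<Longrightarrow> walk T \<alpha> y z (\<alpha> y z)"
  using walk.step[OF walk.refl, of y z T \<alpha>] by simp

text \<open>Antisymmetry of the cocycle negates the contribution of each reversed edge.\<close>

lemma walk_sym:
  assumes "abstract_simplicial_complex T" "cocycle T \<alpha>" "walk T \<alpha> x y s"
  shows "walk T \<alpha> y x (- s)"
  using assms(3)
proof (induction rule: walk.induct)
  case (step x y s z)
  then have "walk T \<alpha> z y (- \<alpha> y z)"
    using walk_edge[of z y T \<alpha>] cocycle_sym[OF assms(1,2), of y z] by (simp add: insert_commute)
  then show ?case
    using walk_trans[OF step.IH, of z "- \<alpha> y z"] by (simp add: algebra_simps)
qed (simp add: walk.refl)

lemma walk_sequence:
  assumes "walk T \<alpha> x y s"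
  shows "\<exists>u m. u 0 = x \<and> u m = y \<and> (\<forall>k<m. {u k, u (Suc k)} \<in> T) \<and> s = (\<Sum>k<m. \<alpha> (u k) (u (Suc k)))"
  using assms
proof (induction rule: walk.induct)
  case (refl x)
  then show ?case
    by (intro exI[of _ "\<lambda>_. x"] exI[of _ 0]) simp
next
  case (step x y s z)
  then obtain u m where u: "u 0 = x" "u m = y" "\<forall>k<m. {u k, u (Suc k)} \<in> T"
    "s = (\<Sum>k<m. \<alpha> (u k) (u (Suc k)))"
    by blast
  then show ?case
    using step.hyps
    by (intro exI[of _ "u(Suc m := z)"] exI[of _ "Suc m"]) (auto simp: less_Suc_eq)
qed

lemma walk_loop:
  fixes M :: "'a::topological_space set"
  assumes "abstract_simplicial_complex T" "cocycle T \<alpha>"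
    and "realization T homeomorphic_space top_of_set M" "simply_connected M" "walk T \<alpha> x x s"
  shows "s = 0"
proof -
  obtain u m where u: "u 0 = x" "u m = x" "\<forall>k<m. {u k, u (Suc k)} \<in> T"
    "s = (\<Sum>k<m. \<alpha> (u k) (u (Suc k)))"
    using walk_sequence[OF assms(5)] by blast
  then show ?thesis
    using cocycle_sum_loop[OF assms(1-4), of m u] by simp
qed

lemma vertex_realization_point:
  assumes "{x} \<in> T"
  shows "(\<lambda>v. if v = x then 1 else 0) \<in> realization_points T"
  using assms by (simp add: realization_points_def)

text \<open>The stars of the vertices reachable from \<open>x\<close> and those of the remaining
  vertices form two open sets that cover the realization. They are disjoint, since two vertices
  positive at one point span an edge and reachability passes along it.\<close>

lemma walk_exists:
  assumes T: "abstract_simplicial_complex T" and con: "connected_space (realization T)"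
    and xy: "{x} \<in> T" "{y} \<in> T"
  shows "\<exists>s. walk T \<alpha> x y s"
proof (rule ccontr)
  assume no: "\<nexists>s. walk T \<alpha> x y s"
  define C where "C = {v. \<exists>s. walk T \<alpha> x v s}"
  define U where "U D = {p \<in> realization_points T. \<exists>v\<in>D. 0 < p v}" for D
  have "openin (realization T) (U D)" for D
    unfolding U_def by (rule openin_realization_stars)
  moreover have "topspace (realization T) \<subseteq> U C \<union> U (- C)"
  proof
    fix p assume "p \<in> topspace (realization T)"
    then have p: "p \<in> realization_points T"
      by (simp add: topspace_realization)
    obtain v where "0 < p v"
      using realization_point_positive[OF T p] by blast
    then show "p \<in> U C \<union> U (- C)"
      using p by (auto simp: U_def)
  qed
  moreover have "U C \<inter> U (- C) = {}"
  proof -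
    have "v' \<in> C" if p: "p \<in> realization_points T" and v: "v \<in> C" "0 < p v" "0 < p v'" for p v v'
    proof -
      have "{v, v'} \<in> T"
        by (rule positive_coordinates_simplex[OF T p]) (use v in auto)
      moreover obtain s where "walk T \<alpha> x v s"
        using v by (auto simp: C_def)
      ultimately have "walk T \<alpha> x v' (s + \<alpha> v v')"
        by (intro walk.step)
      then show ?thesis
        unfolding C_def by blast
    qed
    then show ?thesis
      unfolding U_def by blast
  qed
  moreover have "U C \<noteq> {}"
  proof -
    have "x \<in> C"
      using walk.refl[of T \<alpha> x] by (auto simp: C_def)
    then have "(\<lambda>v. if v = x then 1 else 0) \<in> U C"
      unfolding U_def using vertex_realization_point[OF xy(1)] by (intro CollectI conjI bexI[of _ x]) simp_all
    then show ?thesis by blast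
  qed
  moreover have "U (- C) \<noteq> {}"
  proof -
    have "y \<in> - C"
      using no by (auto simp: C_def)
    then have "(\<lambda>v. if v = y then 1 else 0) \<in> U (- C)"
      unfolding U_def using vertex_realization_point[OF xy(2)] by (intro CollectI conjI bexI[of _ y]) simp_all
    then show ?thesis by blast
  qed
  ultimately show False
    using connected_spaceD[OF con] by blast
qed

text \<open>Induction along a walk, with the zero cocycle as a placeholder.\<close>

lemma constant_on_edges:
  assumes "abstract_simplicial_complex T" "connected_space (realization T)"
    and edge: "\<And>i j. {i, j} \<in> T \<Longrightarrow> f i = f j" and "{x} \<in> T" "{y} \<in> T"
  shows "f x = f y"
proof -
  obtain s where "walk T (\<lambda>_ _. 0) x y s"
    using walk_exists[OF assms(1,2,4,5)] by blast
  then show ?thesis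
    by (induction rule: walk.induct) (simp, metis edge)
qed

lemma cocycle_potential:
  fixes M :: "'a::topological_space set"
  assumes T: "abstract_simplicial_complex T" and \<alpha>: "cocycle T \<alpha>"
    and homeo: "realization T homeomorphic_space top_of_set M"
    and con: "connected_space (realization T)" and sc: "simply_connected M"
  obtains w where "\<And>i j. {i, j} \<in> T \<Longrightarrow> \<alpha> i j = w i - w j"
proof (cases "\<exists>x. {x} \<in> T")
  case True
  then obtain x0 where x0: "{x0} \<in> T" ..
  \<comment> \<open>The potential is the sum along some walk to the base vertex. The choice is
    harmless: going from \<open>i\<close> to \<open>j\<close>, on to \<open>x0\<close> and back to
    \<open>i\<close> is a closed walk, so its sum vanishes.\<close>
  define w where "w x = (SOME s. walk T \<alpha> x x0 s)" for x
  have w: "walk T \<alpha> x x0 (w x)" if "{x} \<in> T" for x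
    unfolding w_def using walk_exists[OF T con that x0] by (rule someI_ex)
  show thesis
  proof (rule that)
    fix i j assume ij: "{i, j} \<in> T"
    then have "{i} \<in> T" "{j} \<in> T"
      using edge_endpoints[OF T] by blast+
    note wi = w[OF this(1)] and wj = w[OF this(2)]
    have "walk T \<alpha> i i ((\<alpha> i j + w j) + - w i)"
      using walk_trans[OF walk_sym[OF T \<alpha> wi] walk_trans[OF wj walk_edge[where \<alpha> = \<alpha>, OF ij]]] .
    then have "(\<alpha> i j + w j) + - w i = 0"
      by (rule walk_loop[OF T \<alpha> homeo sc])
    then show "\<alpha> i j = w i - w j"
      by simp
  qed
next
  \<comment> \<open>Without vertices there are no edges either, and any \<open>w\<close> will
    do.\<close>
  case False
  then have "{i, j} \<notin> T" for i j
    using edge_endpoints[OF T] by blast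
  then show thesis
    using that by blast
qed

section \<open>Maps on equivalence classes\<close>

text \<open>Since \<open>f\<close> is constant on each class, the image of a class is a singleton
  and \<open>the_elem\<close> reads off its value.\<close>

lemma bij_betw_quotient:
  assumes "equiv A r" "f respects r"
    and inj: "\<And>a b. a \<in> A \<Longrightarrow> b \<in> A \<Longrightarrow> f a = f b \<Longrightarrow> (a, b) \<in> r"
    and im: "f ` A = B"
  shows "bij_betw (\<lambda>C. the_elem (f ` C)) (A // r) B"
proof -
  have elem: "the_elem (f ` (r `` {a})) = f a" if "a \<in> A" for a
  proof -
    have "a \<in> r `` {a}"
      using equiv_class_self[OF assms(1) that] .
    moreover have "f b = f a" if "b \<in> r `` {a}" for b
      using assms(2) that by (metis Image_singleton_iff congruentD)
    ultimately have "f ` (r `` {a}) = {f a}"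
      by blast
    then show ?thesis by simp
  qed
  show ?thesis
  proof (rule bij_betw_imageI)
    show "inj_on (\<lambda>C. the_elem (f ` C)) (A // r)"
    proof (rule inj_onI)
      fix C D assume "C \<in> A // r" "D \<in> A // r" and eq: "the_elem (f ` C) = the_elem (f ` D)"
      then obtain a b where ab: "a \<in> A" "b \<in> A" "C = r `` {a}" "D = r `` {b}"
        by (auto elim!: quotientE)
      then have "(a, b) \<in> r"
        using inj elem eq by auto
      then show "C = D"
        using ab equiv_class_eq[OF assms(1)] by blast
    qed
    have "(\<lambda>C. the_elem (f ` C)) ` (A // r) = (\<lambda>a. the_elem (f ` (r `` {a}))) ` A"
      by (auto simp: quotient_def)
    also have "\<dots> = f ` A"
      using elem by (rule image_cong[OF HOL.refl])
    finally show "(\<lambda>C. the_elem (f ` C)) ` (A // r) = B"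
      using im by simp
  qed
qed

section \<open>Passing between weights and dualities\<close>

lemma simplices_1: "e \<in> simplices T 1 \<longleftrightarrow> (\<exists>i j. (i, j) \<in> directed_edges T \<and> e = {i, j})"
  by (auto simp: directed_edges_def simplices_def card_2_iff numeral_2_eq_2[symmetric])

lemma weighted_length_pos:
  assumes "(l, w) \<in> weighted_triangulations T" "(i, j) \<in> directed_edges T"
  shows "0 < l {i, j}"
  using assms by (auto simp: weighted_triangulations_def euclidean_triangulation_def directed_edges_def)

lemma directed_edges_sym: "(i, j) \<in> directed_edges T \<longleftrightarrow> (j, i) \<in> directed_edges T"
  by (simp add: directed_edges_def insert_commute)

lemma duality_of_weighted_sum:
  assumes "(l, w) \<in> weighted_triangulations T" "(i, j) \<in> directed_edges T"
  shows "duality_of_weighted T (l, w) (i, j) + duality_of_weighted T (l, w) (j, i) = l {i, j}"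
  using weighted_length_pos[OF assms] assms(2) directed_edges_sym[of i j T]
  by (simp add: duality_of_weighted_def insert_commute add_divide_distrib[symmetric] power2_eq_square)

lemma duality_of_weighted_diff_squares:
  assumes "(l, w) \<in> weighted_triangulations T" "(i, j) \<in> directed_edges T"
  shows "(duality_of_weighted T (l, w) (i, j))\<^sup>2 - (duality_of_weighted T (l, w) (j, i))\<^sup>2 = w i - w j"
    (is "?a\<^sup>2 - ?b\<^sup>2 = _")
proof -
  have "?a\<^sup>2 - ?b\<^sup>2 = (?a + ?b) * (?a - ?b)"
    by (simp add: power2_eq_square algebra_simps)
  also have "\<dots> = l {i, j} * (?a - ?b)"
    by (simp add: duality_of_weighted_sum[OF assms])
  also have "?a - ?b = (w i - w j) / l {i, j}"
    using weighted_length_pos[OF assms] assms(2) directed_edges_sym[of i j T]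
    by (simp add: duality_of_weighted_def insert_commute diff_divide_distrib[symmetric] field_simps)
  finally show ?thesis
    using weighted_length_pos[OF assms] by simp
qed

text \<open>The weights cancel in the sum over the two directions of an edge, so the lengths can be
  recovered from the duality structure.\<close>

lemma induced_length_duality_of_weighted:
  assumes "(l, w) \<in> weighted_triangulations T"
  shows "induced_length T (duality_of_weighted T (l, w)) = l"
proof (rule extensionalityI[of _ "simplices T 1"])
  show "induced_length T (duality_of_weighted T (l, w)) \<in> extensional (simplices T 1)"
    by (simp add: induced_length_def)
  show "l \<in> extensional (simplices T 1)"
    using assms by (auto simp: weighted_triangulations_def euclidean_triangulation_def PiE_iff)
  fix e assume "e \<in> simplices T 1"
  then show "induced_length T (duality_of_weighted T (l, w)) e = l e"
    using induced_length_edge duality_of_weighted_sum[OF assms] by (metis simplices_1)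
qed

lemma triangle_edges:
  assumes T: "abstract_simplicial_complex T" and ijk: "{i, j, k} \<in> simplices T 2"
  shows "(i, j) \<in> directed_edges T" "(j, k) \<in> directed_edges T" "(k, i) \<in> directed_edges T"
proof -
  have "card {i, j, k} = 3" "{i, j, k} \<in> T"
    using ijk by (auto simp: simplices_def)
  then have "i \<noteq> j" "j \<noteq> k" "k \<noteq> i"
    by (auto simp: card_insert_if split: if_splits)
  moreover have "{i, j} \<in> T" "{j, k} \<in> T" "{k, i} \<in> T"
    by (rule simplex_face[OF T \<open>{i, j, k} \<in> T\<close>]; blast)+
  ultimately show "(i, j) \<in> directed_edges T" "(j, k) \<in> directed_edges T" "(k, i) \<in> directed_edges T"
    by (auto simp: directed_edges_iff)
qed

text \<open>Differences of squares are weight differences, and these cancel cyclically around a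
  triangle.\<close>

lemma duality_of_weighted_in_duality_triangulations:
  assumes T: "abstract_simplicial_complex T" and lw: "(l, w) \<in> weighted_triangulations T"
  shows "duality_of_weighted T (l, w) \<in> duality_triangulations T"
  unfolding duality_triangulations_def
proof (intro CollectI conjI allI impI)
  show "duality_of_weighted T (l, w) \<in> directed_edges T \<rightarrow>\<^sub>E UNIV"
    by (simp add: duality_of_weighted_def)
  show "euclidean_triangulation T (induced_length T (duality_of_weighted T (l, w)))"
    using lw by (simp add: induced_length_duality_of_weighted) (simp add: weighted_triangulations_def)
  fix i j k assume "{i, j, k} \<in> simplices T 2"
  from triangle_edges[OF T this, THEN duality_of_weighted_diff_squares[OF lw]]
  show "(duality_of_weighted T (l, w) (i, j))\<^sup>2 + (duality_of_weighted T (l, w) (j, k))\<^sup>2 +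
      (duality_of_weighted T (l, w) (k, i))\<^sup>2 = (duality_of_weighted T (l, w) (j, i))\<^sup>2 +
      (duality_of_weighted T (l, w) (i, k))\<^sup>2 + (duality_of_weighted T (l, w) (k, j))\<^sup>2"
    by simp
qed

text \<open>For distinct vertices this rearranges the triangle condition; for repeated vertices it
  follows from antisymmetry of the difference.\<close>

lemma cocycle_diff_squares:
  assumes T: "abstract_simplicial_complex T" and d: "d \<in> duality_triangulations T"
  shows "cocycle T (\<lambda>i j. (d (i, j))\<^sup>2 - (d (j, i))\<^sup>2)"
  unfolding cocycle_def
proof (intro allI impI)
  fix i j k assume ijk: "{i, j, k} \<in> T"
  show "(d (i, j))\<^sup>2 - (d (j, i))\<^sup>2 + ((d (j, k))\<^sup>2 - (d (k, j))\<^sup>2) = (d (i, k))\<^sup>2 - (d (k, i))\<^sup>2"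
  proof (cases "i = j \<or> j = k \<or> i = k")
    case False
    then have "{i, j, k} \<in> simplices T 2"
      using ijk by (simp add: simplices_def)
    then have "(d (i, j))\<^sup>2 + (d (j, k))\<^sup>2 + (d (k, i))\<^sup>2 = (d (j, i))\<^sup>2 + (d (i, k))\<^sup>2 + (d (k, j))\<^sup>2"
      using d unfolding duality_triangulations_def by blast
    then show ?thesis
      by linarith
  qed auto
qed

lemma duality_of_weighted_surj:
  fixes M :: "'a::topological_space set"
  assumes T: "abstract_simplicial_complex T"
    and top: "realization T homeomorphic_space top_of_set M"
      "connected_space (realization T)" "simply_connected M"
    and d: "d \<in> duality_triangulations T"
  shows "d \<in> duality_of_weighted T ` weighted_triangulations T"
proof -
  obtain w where w: "\<And>i j. {i, j} \<in> T \<Longrightarrow> (d (i, j))\<^sup>2 - (d (j, i))\<^sup>2 = w i - w j"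
    using cocycle_potential[OF T cocycle_diff_squares[OF T d] top] by blast
  define l where "l = induced_length T d"
  \<comment> \<open>Weights must be extensional; on vertices \<open>w'\<close> agrees with the
    potential.\<close>
  define w' where "w' = restrict w (vertices T)"
  have lw: "(l, w') \<in> weighted_triangulations T"
    using d by (simp add: weighted_triangulations_def duality_triangulations_def l_def w'_def)
  have "d = duality_of_weighted T (l, w')"
  proof (rule extensionalityI[of _ "directed_edges T"])
    show "d \<in> extensional (directed_edges T)"
      using d by (auto simp: duality_triangulations_def PiE_iff)
    show "duality_of_weighted T (l, w') \<in> extensional (directed_edges T)"
      by (simp add: duality_of_weighted_def)
    fix e assume "e \<in> directed_edges T"
    then obtain i j where e: "e = (i, j)" and ij: "(i, j) \<in> directed_edges T"
      by (cases e) auto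
    then have edge: "{i, j} \<in> T"
      by (simp add: directed_edges_iff)
    then have "{i} \<in> T" "{j} \<in> T"
      using edge_endpoints[OF T] by blast+
    then have "w' i - w' j = (d (i, j))\<^sup>2 - (d (j, i))\<^sup>2"
      using w[OF edge] by (simp add: w'_def vertices_def simplices_def)
    moreover have l: "l {i, j} = d (i, j) + d (j, i)"
      using induced_length_edge[OF ij] by (simp add: l_def)
    \<comment> \<open>With \<open>a = d (i, j)\<close> and \<open>b = d (j, i)\<close> this is
      \<open>(a + b)\<^sup>2 + a\<^sup>2 - b\<^sup>2 = 2 * a * (a + b)\<close>.\<close>
    ultimately have "(l {i, j})\<^sup>2 + w' i - w' j = d (i, j) * (2 * l {i, j})"
      by (simp add: power2_eq_square algebra_simps)
    then show "d e = duality_of_weighted T (l, w') e"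
      using ij weighted_length_pos[OF lw ij] by (simp add: e duality_of_weighted_def)
  qed
  then show ?thesis
    using lw by blast
qed

text \<open>Equal dualities have equal lengths and equal weight differences along edges. Hence
  \<open>w' i - w i\<close> is constant along edges, and by connectedness on all vertices.\<close>

lemma duality_of_weighted_eqD:
  assumes T: "abstract_simplicial_complex T" and con: "connected_space (realization T)"
    and lw: "(l, w) \<in> weighted_triangulations T" "(l', w') \<in> weighted_triangulations T"
    and eq: "duality_of_weighted T (l, w) = duality_of_weighted T (l', w')"
  shows "((l, w), (l', w')) \<in> weight_scaling T"
proof -
  have "l' = l"
    using induced_length_duality_of_weighted lw eq by metis
  moreover have "\<exists>t. \<forall>i\<in>vertices T. w' i = w i + t"
  proof (cases "vertices T = {}")
    case False
    then obtain x where x: "x \<in> vertices T" by blast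
    have edge: "w' i - w i = w' j - w j" if "{i, j} \<in> T" for i j
    proof (cases "i = j")
      case False
      then have "(i, j) \<in> directed_edges T"
        using that by (simp add: directed_edges_iff)
      from lw[THEN duality_of_weighted_diff_squares, OF this] show ?thesis
        unfolding eq by linarith
    qed simp
    have "w' i - w i = w' x - w x" if "i \<in> vertices T" for i
    proof -
      have "{i} \<in> T" "{x} \<in> T"
        using that x by (auto simp: vertices_def simplices_def)
      then show ?thesis
        using constant_on_edges[where f = "\<lambda>i. w' i - w i", OF T con edge] by blast
    qed
    then show ?thesis
      by (intro exI[of _ "w' x - w x"]) (metis diff_add_cancel add.commute)
  qed simp
  ultimately show ?thesis
    using lw by (simp add: weight_scaling_def)
qed

section \<open>Weight scaling and the induced bijection\<close>

lemma weight_scaling_iff: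
  "(a, b) \<in> weight_scaling T \<longleftrightarrow> a \<in> weighted_triangulations T \<and> b \<in> weighted_triangulations T \<and>
     fst b = fst a \<and> (\<exists>t. \<forall>i\<in>vertices T. snd b i = snd a i + t)"
  by (cases a, cases b) (simp add: weight_scaling_def)

lemma equiv_weight_scaling: "equiv (weighted_triangulations T) (weight_scaling T)"
proof (rule equivI)
  show "weight_scaling T \<subseteq> weighted_triangulations T \<times> weighted_triangulations T"
    by (auto simp: weight_scaling_iff)
  show "refl_on (weighted_triangulations T) (weight_scaling T)"
    by (auto simp: refl_on_def weight_scaling_iff intro: exI[of _ 0])
  show "sym (weight_scaling T)"
  proof (rule symI)
    fix a b assume ab: "(a, b) \<in> weight_scaling T"
    then obtain t where "\<forall>i\<in>vertices T. snd b i = snd a i + t"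
      unfolding weight_scaling_iff by blast
    then have "\<forall>i\<in>vertices T. snd a i = snd b i + - t"
      by simp
    then show "(b, a) \<in> weight_scaling T"
      using ab unfolding weight_scaling_iff by metis
  qed
  show "trans (weight_scaling T)"
  proof (rule transI)
    fix a b c assume ab: "(a, b) \<in> weight_scaling T" and bc: "(b, c) \<in> weight_scaling T"
    obtain t t' where "\<forall>i\<in>vertices T. snd b i = snd a i + t" "\<forall>i\<in>vertices T. snd c i = snd b i + t'"
      using ab bc unfolding weight_scaling_iff by blast
    then have "\<forall>i\<in>vertices T. snd c i = snd a i + (t + t')"
      by simp
    then show "(a, c) \<in> weight_scaling T"
      using ab bc unfolding weight_scaling_iff by metis
  qed
qed

text \<open>Only weight differences at the ends of an edge enter, and a common shift cancels in
  them.\<close>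

lemma duality_of_weighted_respects:
  assumes T: "abstract_simplicial_complex T"
  shows "duality_of_weighted T respects weight_scaling T"
proof (rule congruentI)
  fix a b assume "(a, b) \<in> weight_scaling T"
  then obtain l w w' t where ab: "a = (l, w)" "b = (l, w')" and t: "\<forall>i\<in>vertices T. w' i = w i + t"
    by (auto simp: weight_scaling_def)
  have "w i - w j = w' i - w' j" if "(i, j) \<in> directed_edges T" for i j
  proof -
    have "{i, j} \<in> T"
      using that by (simp add: directed_edges_iff)
    then have "{i} \<in> T" "{j} \<in> T"
      using edge_endpoints[OF T] by blast+
    then show ?thesis
      using t by (simp add: vertices_def simplices_def)
  qed
  then show "duality_of_weighted T a = duality_of_weighted T b"
    unfolding duality_of_weighted_def ab prod.case
    by (intro restrict_ext) (auto simp: add_diff_eq[symmetric])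
qed

theorem corollary12:
  fixes n :: nat
    and M :: "'a::topological_space set"
    and T :: "'v set set"
  assumes "triangulation_of_manifold n T (top_of_set M)"
    and "connected M"
    and "simply_connected M"
  shows "equiv (weighted_triangulations T) (weight_scaling T) \<and>
         duality_of_weighted T respects weight_scaling T \<and>
         bij_betw (\<lambda>C. the_elem (duality_of_weighted T ` C))
           (weighted_triangulations T // weight_scaling T) (duality_triangulations T)"
proof -
  have T: "abstract_simplicial_complex T" and homeo: "realization T homeomorphic_space top_of_set M"
    using assms(1) by (auto simp: triangulation_of_manifold_def)
  have con: "connected_space (realization T)"
    using homeomorphic_connected_space[OF homeo] assms(2)
    by (simp add: connectedin_def flip: connectedin_iff_connected)
  have "bij_betw (\<lambda>C. the_elem (duality_of_weighted T ` C))
      (weighted_triangulations T // weight_scaling T) (duality_triangulations T)"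
  proof (rule bij_betw_quotient[OF equiv_weight_scaling duality_of_weighted_respects[OF T]])
    show "(a, b) \<in> weight_scaling T" if "a \<in> weighted_triangulations T"
      "b \<in> weighted_triangulations T" "duality_of_weighted T a = duality_of_weighted T b" for a b
      using that duality_of_weighted_eqD[OF T con] by (cases a, cases b) blast
    show "duality_of_weighted T ` weighted_triangulations T = duality_triangulations T"
      using duality_of_weighted_in_duality_triangulations[OF T]
        duality_of_weighted_surj[OF T homeo con assms(3)] by auto
  qed
  then show ?thesis
    using equiv_weight_scaling duality_of_weighted_respects[OF T] by blast
qed

end
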